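(* There is an absolute constant $C$ such that the following holds. Let $f\colon \{-1,1\}^n \to [-1,1]$ be a homogeneous function of degree $d\ge 2$. Then \[ \mathrm{Inf}[f] \leq \|\Delta(f)\|_\infty \leq C\, d\log d. \]
   Context: Every $f\colon\{-1,1\}^n\to\mathbb{R}$ has a unique representation as a multilinear polynomial $\sum_{S\subseteq[n]}\hat f(S)\prod_{i\in S}x_i$; its degree is the degree of this polynomial, and $f$ is homogeneous if all monomials with nonzero coefficient have the same degree. With $x\oplus e_i$ the point $x$ with $i$th coordinate flipped, $f_i(x)=\frac{f(x)-f(x\oplus e_i)}{2}$, $\Delta(f)(x)=\sum_{i=1}^n|f_i(x)|$, $\mathrm{Inf}[f]=\sum_i\mathbb{E}_x|f_i(x)|$ ($x$ uniform), and $\|\Delta(f)\|_\infty=\max_x\Delta(f)(x)$. *)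

theory Defs
  imports Complex_Main "HOL-Library.FuncSet"
begin

definition cube :: "nat \<Rightarrow> (nat \<Rightarrow> real) set" where
  "cube n = {1..n} \<rightarrow>\<^sub>E {-1, 1}"

definition multilinear :: "nat \<Rightarrow> (nat set \<Rightarrow> real) \<Rightarrow> (nat \<Rightarrow> real) \<Rightarrow> real" where
  "multilinear n c x = (\<Sum>S\<in>Pow {1..n}. c S * (\<Prod>i\<in>S. x i))"

text \<open>Coefficient families are set to zero off the subsets of \<open>{1..n}\<close>, so that the
  representing family is unique as a function; see \<open>represents_ex1\<close>.\<close>

definition represents :: "nat \<Rightarrow> (nat set \<Rightarrow> real) \<Rightarrow> ((nat \<Rightarrow> real) \<Rightarrow> real) \<Rightarrow> bool" where
  "represents n c f \<longleftrightarrow>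
     (\<forall>x\<in>cube n. f x = multilinear n c x) \<and> (\<forall>S. \<not> S \<subseteq> {1..n} \<longrightarrow> c S = 0)"

definition fourier_coeff :: "nat \<Rightarrow> ((nat \<Rightarrow> real) \<Rightarrow> real) \<Rightarrow> nat set \<Rightarrow> real" where
  "fourier_coeff n f = (THE c. represents n c f)"

definition fourier_support :: "nat \<Rightarrow> ((nat \<Rightarrow> real) \<Rightarrow> real) \<Rightarrow> nat set set" where
  "fourier_support n f = {S. S \<subseteq> {1..n} \<and> fourier_coeff n f S \<noteq> 0}"

text \<open>The zero function gets degree \<open>0\<close>.\<close>

definition cube_degree :: "nat \<Rightarrow> ((nat \<Rightarrow> real) \<Rightarrow> real) \<Rightarrow> nat" where
  "cube_degree n f = Max (insert 0 (card ` fourier_support n f))"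

definition homogeneous :: "nat \<Rightarrow> ((nat \<Rightarrow> real) \<Rightarrow> real) \<Rightarrow> bool" where
  "homogeneous n f \<longleftrightarrow>
     (\<forall>S\<in>fourier_support n f. \<forall>T\<in>fourier_support n f. card S = card T)"

definition flip :: "nat \<Rightarrow> (nat \<Rightarrow> real) \<Rightarrow> nat \<Rightarrow> real" where
  "flip i x = x(i := - x i)"

definition partial_diff :: "nat \<Rightarrow> ((nat \<Rightarrow> real) \<Rightarrow> real) \<Rightarrow> (nat \<Rightarrow> real) \<Rightarrow> real" where
  "partial_diff i f x = (f x - f (flip i x)) / 2"

definition sensitivity :: "nat \<Rightarrow> ((nat \<Rightarrow> real) \<Rightarrow> real) \<Rightarrow> (nat \<Rightarrow> real) \<Rightarrow> real" where
  "sensitivity n f x = (\<Sum>i=1..n. \<bar>partial_diff i f x\<bar>)"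

definition max_sensitivity :: "nat \<Rightarrow> ((nat \<Rightarrow> real) \<Rightarrow> real) \<Rightarrow> real" where
  "max_sensitivity n f = Max (sensitivity n f ` cube n)"

definition cube_expectation :: "nat \<Rightarrow> ((nat \<Rightarrow> real) \<Rightarrow> real) \<Rightarrow> real" where
  "cube_expectation n g = (\<Sum>x\<in>cube n. g x) / real (card (cube n))"

definition total_influence :: "nat \<Rightarrow> ((nat \<Rightarrow> real) \<Rightarrow> real) \<Rightarrow> real" where
  "total_influence n f = (\<Sum>i=1..n. cube_expectation n (\<lambda>x. \<bar>partial_diff i f x\<bar>))"

lemma finite_cube: "finite (cube n)"
  unfolding cube_def by (intro finite_PiE) auto

lemma cube_nonempty: "cube n \<noteq> {}"
  by (simp add: cube_def PiE_eq_empty_iff)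

lemma flip_in_cube: "x \<in> cube n \<Longrightarrow> i \<in> {1..n} \<Longrightarrow> flip i x \<in> cube n"
  unfolding cube_def flip_def by (fastforce simp: PiE_iff extensional_def)

lemma sum_Pow_insert:
  fixes c :: "'a set \<Rightarrow> real" and x :: "'a \<Rightarrow> real"
  assumes "finite A" "a \<notin> A"
  shows "(\<Sum>S\<in>Pow (insert a A). c S * (\<Prod>i\<in>S. x i)) =
    (\<Sum>S\<in>Pow A. c S * (\<Prod>i\<in>S. x i)) +
    x a * (\<Sum>S\<in>Pow A. c (insert a S) * (\<Prod>i\<in>S. x i))"
proof -
  have "inj_on (insert a) (Pow A)"
    using assms(2) by (auto simp: inj_on_def)
  moreover have "(\<Prod>i\<in>insert a S. x i) = x a * (\<Prod>i\<in>S. x i)" if "S \<in> Pow A" for S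
  proof -
    have "finite S" "a \<notin> S"
      using that assms finite_subset by auto
    then show ?thesis by simp
  qed
  ultimately have "(\<Sum>S\<in>insert a ` Pow A. c S * (\<Prod>i\<in>S. x i)) =
      x a * (\<Sum>S\<in>Pow A. c (insert a S) * (\<Prod>i\<in>S. x i))"
    by (simp add: sum.reindex sum_distrib_left mult_ac)
  moreover have "Pow A \<inter> insert a ` Pow A = {}"
    using assms(2) by auto
  ultimately show ?thesis
    using assms(1) by (simp add: Pow_insert sum.union_disjoint)
qed

lemma prod_upd_Pow:
  fixes x :: "'a \<Rightarrow> real"
  assumes "a \<notin> A"
  shows "(\<Sum>S\<in>Pow A. c S * (\<Prod>i\<in>S. (x(a := t)) i)) =
    (\<Sum>S\<in>Pow A. c S * (\<Prod>i\<in>S. x i))"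
proof (intro sum.cong refl arg_cong2[where f = "(*)"] prod.cong)
  fix S i assume "S \<in> Pow A" "i \<in> S"
  then show "(x(a := t)) i = x i" using assms by auto
qed

lemma multilinear_zero:
  fixes c :: "'a set \<Rightarrow> real"
  assumes "finite A"
    and "\<And>x. x \<in> A \<rightarrow>\<^sub>E {-1, 1} \<Longrightarrow> (\<Sum>S\<in>Pow A. c S * (\<Prod>i\<in>S. x i)) = 0"
    and "S \<subseteq> A"
  shows "c S = 0"
  using assms
proof (induction A arbitrary: c S rule: finite_induct)
  case empty
  then show ?case by simp
next
  case (insert a A)
  have *: "(\<Sum>S\<in>Pow A. c S * (\<Prod>i\<in>S. x i)) = 0 \<and>
      (\<Sum>S\<in>Pow A. c (insert a S) * (\<Prod>i\<in>S. x i)) = 0"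
    if x: "x \<in> A \<rightarrow>\<^sub>E {-1, 1}" for x
  proof -
    have "x(a := t) \<in> insert a A \<rightarrow>\<^sub>E {-1, 1}" if "t \<in> {-1, 1}" for t
      using x that by (auto simp: PiE_iff extensional_def)
    from insert.prems(1)[OF this[of 1]] insert.prems(1)[OF this[of "-1"]]
    show ?thesis
      unfolding sum_Pow_insert[OF insert.hyps] prod_upd_Pow[OF insert.hyps(2)] by simp
  qed
  have 0: "c T = 0" "c (insert a T) = 0" if "T \<subseteq> A" for T
    using insert.IH[of c T] insert.IH[of "\<lambda>S. c (insert a S)" T] * that by auto
  show ?case
  proof (cases "a \<in> S")
    case True
    then show ?thesis using 0(2)[of "S - {a}"] insert.prems(2) by (auto simp: insert_absorb)
  next
    case False
    then show ?thesis using 0(1)[of S] insert.prems(2) by auto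
  qed
qed

lemma multilinear_ex:
  fixes f :: "('a \<Rightarrow> real) \<Rightarrow> real"
  assumes "finite A"
  shows "\<exists>c. \<forall>x\<in>A \<rightarrow>\<^sub>E {-1, 1}. f x = (\<Sum>S\<in>Pow A. c S * (\<Prod>i\<in>S. x i))"
  using assms
proof (induction A arbitrary: f rule: finite_induct)
  case empty
  show ?case by (rule exI[of _ "\<lambda>_. f (\<lambda>_. undefined)"]) simp
next
  case (insert a A)
  obtain p where "\<forall>x\<in>A \<rightarrow>\<^sub>E {-1, 1}.
      (f (x(a := 1)) + f (x(a := -1))) / 2 = (\<Sum>S\<in>Pow A. p S * (\<Prod>i\<in>S. x i))"
    by (rule exE[OF insert.IH[of "\<lambda>x. (f (x(a := 1)) + f (x(a := -1))) / 2"]])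
  note p = bspec[OF this]
  obtain q where "\<forall>x\<in>A \<rightarrow>\<^sub>E {-1, 1}.
      (f (x(a := 1)) - f (x(a := -1))) / 2 = (\<Sum>S\<in>Pow A. q S * (\<Prod>i\<in>S. x i))"
    by (rule exE[OF insert.IH[of "\<lambda>x. (f (x(a := 1)) - f (x(a := -1))) / 2"]])
  note q = bspec[OF this]
  define c where "c S = (if a \<in> S then q (S - {a}) else p S)" for S
  have c1: "(\<Sum>S\<in>Pow A. c S * (\<Prod>i\<in>S. x i)) = (\<Sum>S\<in>Pow A. p S * (\<Prod>i\<in>S. x i))" for x
    using insert.hyps(2) by (intro sum.cong) (auto simp: c_def)
  have "c (insert a S) = q S" if "S \<subseteq> A" for S
  proof -
    have "a \<notin> S" using that insert.hyps(2) by blast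
    then show ?thesis by (simp add: c_def)
  qed
  then have c2: "(\<Sum>S\<in>Pow A. c (insert a S) * (\<Prod>i\<in>S. x i)) =
      (\<Sum>S\<in>Pow A. q S * (\<Prod>i\<in>S. x i))" for x
    by (intro sum.cong) auto
  have "f x = (\<Sum>S\<in>Pow (insert a A). c S * (\<Prod>i\<in>S. x i))"
    if x: "x \<in> insert a A \<rightarrow>\<^sub>E {-1, 1}" for x
  proof -
    define y where "y = x(a := undefined)"
    have y: "y \<in> A \<rightarrow>\<^sub>E {-1, 1}"
      using x insert.hyps(2) by (auto simp: y_def PiE_iff extensional_def)
    have xa: "x a = 1 \<or> x a = -1" using x by (auto simp: PiE_iff)
    have "y(a := x a) = x" by (simp add: y_def)
    then have "f x = (f (y(a := 1)) + f (y(a := -1))) / 2 + x a * ((f (y(a := 1)) - f (y(a := -1))) / 2)"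
      using xa by (elim disjE) (simp_all add: field_simps)
    also have "\<dots> = (\<Sum>S\<in>Pow A. p S * (\<Prod>i\<in>S. x i)) + x a * (\<Sum>S\<in>Pow A. q S * (\<Prod>i\<in>S. x i))"
      unfolding p[OF y] q[OF y] unfolding y_def prod_upd_Pow[OF insert.hyps(2)] ..
    finally show ?thesis
      unfolding sum_Pow_insert[OF insert.hyps] c1 c2 .
  qed
  then show ?case by (intro exI[of _ c] ballI)
qed

lemma represents_ex1: "\<exists>!c. represents n c f"
proof -
  obtain c where c: "\<forall>x\<in>cube n. f x = multilinear n c x"
    using multilinear_ex[of "{1..n}" f] unfolding cube_def multilinear_def by auto
  have "multilinear n (\<lambda>S. if S \<subseteq> {1..n} then c S else 0) x = multilinear n c x" for x
    unfolding multilinear_def by (intro sum.cong) auto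
  with c have "represents n (\<lambda>S. if S \<subseteq> {1..n} then c S else 0) f"
    by (simp add: represents_def)
  moreover have "c = d" if cd: "represents n c f" "represents n d f" for c d
  proof
    fix S
    show "c S = d S"
    proof (cases "S \<subseteq> {1..n}")
      case True
      have "(\<Sum>S\<in>Pow {1..n}. (c S - d S) * (\<Prod>i\<in>S. x i)) = 0"
        if "x \<in> {1..n} \<rightarrow>\<^sub>E {-1, 1}" for x
      proof -
        have "multilinear n c x = multilinear n d x"
          using cd that by (auto simp: represents_def cube_def)
        then show ?thesis
          by (simp add: multilinear_def left_diff_distrib sum_subtractf)
      qed
      then show ?thesis
        using multilinear_zero[of "{1..n}" "\<lambda>S. c S - d S" S] True by simp
    next
      case False
      then show ?thesis using cd by (simp add: represents_def)
    qed
  qed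
  ultimately show ?thesis by blast
qed

lemma represents_fourier_coeff: "represents n (fourier_coeff n f) f"
  unfolding fourier_coeff_def by (rule theI'[OF represents_ex1])

end

theory Submission
  imports Defs "HOL-Complex_Analysis.Complex_Analysis"
begin

text \<open>
  Fix a point \<open>x\<close> of the cube and let \<open>s\<^sub>i\<close> be the sign of \<open>f\<^sub>i(x)\<close>. Let \<open>f\<close> also denote the
  multilinear extension, and put
  \<open>h(v) = f(x\<^sub>1((1 + v) + \<i>s\<^sub>1(1 - v))/2, \<dots>, x\<^sub>n((1 + v) + \<i>s\<^sub>n(1 - v))/2)\<close>, a polynomial of
  degree at most \<open>d\<close>. For \<open>v = w\<^sup>2\<close> on the unit circle the arguments are
  \<open>w x\<^sub>i (Re w + s\<^sub>i Im w)\<close>, so homogeneity and \<open>\<bar>f\<bar> \<le> 1\<close> on \<open>[-1,1]\<^sup>n\<close> give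
  \<open>\<bar>h(v)\<bar> \<le> (1 + \<bar>Im w\<bar>)\<^sup>d \<le> exp (d \<bar>Im w\<bar>)\<close>, while \<open>\<Delta>(f)(x) = -2 Im h'(1)\<close>.

  A product \<open>R\<close> of powers of normalised geometric sums \<open>(1 + v + \<dots> + v\<^sup>M\<^sup>-\<^sup>1)/M\<close>, one power of degree
  \<open>O(d)\<close> for each of the \<open>O(log d)\<close> dyadic scales of \<open>\<bar>Im w\<bar>\<close> between \<open>1/d\<close> and \<open>1\<close>, satisfies
  \<open>R(1) = 1\<close> and \<open>\<bar>R(w\<^sup>2)\<bar> \<le> 3 exp (-d \<bar>Im w\<bar>)\<close>. Hence \<open>h R\<close> and \<open>R\<close> have degree \<open>O(d log d)\<close> and are
  bounded on the circle, and Bernstein's inequality bounds \<open>h'(1) = (h R)'(1) - h(1) R'(1)\<close>.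
\<close>

section \<open>Bernstein's inequality on the unit circle\<close>

lemma norm_poly_le_unit_disc:
  fixes p :: "complex poly"
  assumes "\<And>z. norm z = 1 \<Longrightarrow> norm (poly p z) \<le> B" and "norm z \<le> 1"
  shows "norm (poly p z) \<le> B"
proof (rule maximum_modulus_frontier[where S = "cball 0 1" and f = "poly p"])
  show "norm (poly p z) \<le> B" if "z \<in> frontier (cball 0 1)" for z
    using that assms(1) by (simp add: frontier_cball)
qed (use assms(2) in \<open>auto intro!: holomorphic_intros continuous_intros\<close>)

text \<open>The reversed polynomial \<open>z^deg * p (1/z)\<close> has the same bound on the circle,
  so the maximum modulus principle applies to it at \<open>1/z\<close>.\<close>

lemma norm_poly_le_outside_unit_disc:
  fixes p :: "complex poly"
  assumes B: "\<And>z. norm z = 1 \<Longrightarrow> norm (poly p z) \<le> B" and z: "norm z \<ge> 1"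
  shows "norm (poly p z) \<le> B * norm z ^ degree p"
proof -
  have z0: "z \<noteq> 0" using z by auto
  have "norm (poly (reflect_poly p) (inverse z)) \<le> B"
  proof (rule norm_poly_le_unit_disc)
    fix u :: complex assume u: "norm u = 1"
    then have "u \<noteq> 0" by auto
    then show "norm (poly (reflect_poly p) u) \<le> B"
      using B[of "inverse u"] u by (simp add: poly_reflect_poly_nz norm_mult norm_power norm_inverse)
  next
    show "norm (inverse z) \<le> 1" using z by (simp add: norm_inverse inverse_le_1_iff)
  qed
  moreover have "norm (poly (reflect_poly p) (inverse z)) = norm (poly p z) / norm z ^ degree p"
    using z0 by (simp add: poly_reflect_poly_nz norm_mult norm_power norm_inverse power_inverse
        divide_inverse mult.commute)
  ultimately show ?thesis
    using z0 by (simp add: pos_divide_le_eq)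
qed

text \<open>Cauchy's estimate on the circle of radius \<open>1/n\<close> about \<open>w\<close>:
  there \<open>p\<close> exceeds \<open>B\<close> by at most the factor
  \<open>(1 + 1/n)^n \<le> e\<close>. The loss of \<open>e\<close> against the sharp bound
  \<open>B * n\<close> only affects the absolute constant.\<close>

lemma bernstein_unit_circle:
  fixes p :: "complex poly"
  assumes B: "\<And>z. norm z = 1 \<Longrightarrow> norm (poly p z) \<le> B"
    and n: "degree p \<le> n" "n > 0" and w: "norm w = 1"
  shows "norm (poly (pderiv p) w) \<le> exp 1 * B * n"
proof -
  have B0: "B \<ge> 0" using order_trans[OF norm_ge_zero B[of 1]] by simp
  have "norm ((deriv ^^ 1) (poly p) w) \<le> fact 1 * (exp 1 * B) / (1 / n) ^ 1"
  proof (rule Cauchy_inequality)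
    fix z assume z: "norm (w - z) = 1 / n"
    have zn: "norm z \<le> 1 + 1 / n"
      using norm_triangle_ineq2[of z w] z w by (simp add: norm_minus_commute)
    have e: "(1 + 1 / real n) ^ n \<le> exp 1"
      using exp_ge_one_plus_x_over_n_power_n[of n 1] n by simp
    show "norm (poly p z) \<le> exp 1 * B"
    proof (cases "norm z \<ge> 1")
      case True
      have "norm (poly p z) \<le> B * norm z ^ degree p"
        using norm_poly_le_outside_unit_disc[OF B True] .
      also have "\<dots> \<le> B * norm z ^ n"
        using True n B0 by (intro mult_left_mono power_increasing) auto
      also have "\<dots> \<le> B * (1 + 1 / n) ^ n"
        using zn B0 by (intro mult_left_mono power_mono) auto
      also have "\<dots> \<le> B * exp 1"
        using e B0 by (intro mult_left_mono) auto
      finally show ?thesis by (simp add: mult.commute)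
    next
      case False
      then have "norm (poly p z) \<le> 1 * B"
        using norm_poly_le_unit_disc[OF B, of z] by simp
      also have "\<dots> \<le> exp 1 * B"
        using B0 by (intro mult_right_mono) auto
      finally show ?thesis .
    qed
  qed (use n in \<open>auto intro!: holomorphic_intros continuous_intros\<close>)
  moreover have "deriv (poly p) w = poly (pderiv p) w"
    by (intro DERIV_imp_deriv) simp
  ultimately show ?thesis by (simp add: mult_ac)
qed

section \<open>Polynomials decaying away from 1 on the unit circle\<close>

text \<open>On the unit circle this is, up to a unimodular factor, a normalised Dirichlet
  kernel.\<close>

definition geom_mean_poly :: "nat \<Rightarrow> complex poly" where
  "geom_mean_poly M = smult (1 / of_nat M) (\<Sum>j<M. monom 1 j)"

lemma poly_geom_mean_poly: "poly (geom_mean_poly M) v = (\<Sum>j<M. v ^ j) / of_nat M"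
  by (simp add: geom_mean_poly_def poly_sum poly_monom)

lemma degree_geom_mean_poly: "degree (geom_mean_poly M) \<le> M"
  unfolding geom_mean_poly_def
  by (intro order_trans[OF degree_smult_le] degree_sum_le)
     (auto intro: order_trans[OF degree_monom_le])

lemma norm_geom_mean_poly_le_1:
  assumes "norm v = 1"
  shows "norm (poly (geom_mean_poly M) v) \<le> 1"
proof -
  have "norm (\<Sum>j<M. v ^ j) \<le> (\<Sum>j<M. 1)"
    using assms by (intro order_trans[OF norm_sum] sum_mono) (simp add: norm_power)
  then show ?thesis
    by (simp add: poly_geom_mean_poly norm_divide divide_le_eq)
qed

text \<open>On the circle \<open>cnj w\<close> inverts \<open>w\<close>, so \<open>1 - w^2\<close>
  factors as \<open>w * (cnj w - w)\<close>. Thus \<open>\<bar>Im w\<bar>\<close> measures the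
  distance of \<open>v = w^2\<close> from 1.\<close>

lemma norm_one_minus_square_unit:
  fixes w :: complex
  assumes "norm w = 1"
  shows "norm (1 - w\<^sup>2) = 2 * \<bar>Im w\<bar>"
proof -
  have "w * cnj w = 1" using assms by (simp add: complex_norm_square[symmetric])
  then have "1 - w\<^sup>2 = w * (cnj w - w)" by (simp add: power2_eq_square algebra_simps)
  also have "cnj w - w = - (2 * \<i> * of_real (Im w))" by (simp add: complex_eq_iff)
  finally show ?thesis using assms by (simp add: norm_mult)
qed

text \<open>Multiplying by \<open>1 - w^2\<close> telescopes the geometric sum to a difference of
  two unit numbers.\<close>

lemma norm_geom_mean_poly_le:
  assumes "norm w = 1" "Im w \<noteq> 0" "M > 0"
  shows "norm (poly (geom_mean_poly M) (w\<^sup>2)) \<le> 1 / (M * \<bar>Im w\<bar>)"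
proof -
  have "norm (1 - w\<^sup>2) * norm (\<Sum>j<M. (w\<^sup>2) ^ j) = norm (1 - (w\<^sup>2) ^ M)"
    by (simp add: one_diff_power_eq norm_mult)
  also have "\<dots> \<le> 2"
    using norm_triangle_ineq4[of 1 "(w\<^sup>2) ^ M"] assms(1) by (simp add: norm_power)
  finally have "norm (\<Sum>j<M. (w\<^sup>2) ^ j) \<le> 1 / \<bar>Im w\<bar>"
    using assms by (simp add: norm_one_minus_square_unit field_simps)
  then have "norm (\<Sum>j<M. (w\<^sup>2) ^ j) / M \<le> 1 / \<bar>Im w\<bar> / M"
    by (intro divide_right_mono) auto
  then show ?thesis
    by (simp add: poly_geom_mean_poly norm_divide mult.commute)
qed

lemma dyadic_scale:
  fixes r :: real
  assumes "r \<le> 1"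
  shows "r \<le> (1/2) ^ K \<or> (\<exists>k<K. (1/2) ^ Suc k \<le> r \<and> r \<le> (1/2) ^ k)"
proof (induction K)
  case (Suc K)
  then show ?case by (metis less_Suc_eq linorder_linear)
qed (use assms in simp)

text \<open>For \<open>\<bar>Im w\<bar>\<close> at least \<open>(1/2)^(k+1)\<close>, the length
  \<open>3 * 2^(k+1)\<close> makes the geometric mean at most \<open>1/3 \<le> 1/e\<close>. The
  exponent \<open>d div 2^k + 1\<close> exceeds \<open>d / 2^k\<close>, hence
  \<open>d * \<bar>Im w\<bar>\<close>; the \<open>+ 1\<close> compensates for rounding down.\<close>

lemma dyadic_kernel_decay:
  assumes w: "norm w = 1" and r: "(1/2) ^ Suc k \<le> \<bar>Im w\<bar>" "\<bar>Im w\<bar> \<le> (1/2) ^ k"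
  shows "norm (poly (geom_mean_poly (3 * 2 ^ Suc k) ^ (d div 2 ^ k + 1)) (w\<^sup>2))
    \<le> exp (- (d * \<bar>Im w\<bar>))"
proof -
  let ?j = "d div 2 ^ k + 1"
  have pos: "\<bar>Im w\<bar> > 0" using r(1) by (rule less_le_trans[rotated]) simp
  have "norm (poly (geom_mean_poly (3 * 2 ^ Suc k)) (w\<^sup>2)) \<le> 1 / (real (3 * 2 ^ Suc k) * \<bar>Im w\<bar>)"
    using w pos by (intro norm_geom_mean_poly_le) auto
  also have "\<dots> \<le> 1 / 3"
    using r(1) pos by (simp add: field_simps)
  also have "1 / 3 \<le> exp (-1 :: real)"
    using exp_le by (simp add: exp_minus field_simps)
  finally have "norm (poly (geom_mean_poly (3 * 2 ^ Suc k)) (w\<^sup>2)) ^ ?j \<le> exp (-1) ^ ?j"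
    by (intro power_mono) auto
  also have "\<dots> = exp (- real ?j)"
    by (simp only: exp_of_nat_mult[symmetric] mult_minus_right mult_1_right)
  also have "\<dots> \<le> exp (- (d * \<bar>Im w\<bar>))"
  proof -
    have "d \<le> 2 ^ k * ?j"
      using dividend_less_times_div[of "2 ^ k" d] by (simp add: algebra_simps)
    then have "real d \<le> 2 ^ k * real ?j"
      by (metis of_nat_le_iff of_nat_mult of_nat_numeral of_nat_power)
    then have "d * (1/2) ^ k \<le> real ?j"
      by (simp add: power_divide field_simps)
    moreover have "d * \<bar>Im w\<bar> \<le> d * (1/2) ^ k"
      using r(2) by (intro mult_left_mono) auto
    ultimately show ?thesis by simp
  qed
  finally show ?thesis by (simp only: poly_power norm_power)
qed

lemma half_le_ln_2: "1 / 2 \<le> ln (2 :: real)"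
proof -
  have "exp (1 / 2 :: real) ^ 2 \<le> 2 ^ 2"
    using exp_le by (simp add: exp_of_nat_mult[symmetric])
  then have "exp (1 / 2 :: real) \<le> 2"
    by (rule power2_le_imp_le) simp
  then show ?thesis by (subst ln_ge_iff) auto
qed

text \<open>On each dyadic shell of \<open>\<bar>Im w\<bar>\<close> one factor supplies the whole
  decay, while the others have modulus at most 1 on the circle.\<close>

lemma exists_decaying_poly:
  fixes d :: nat
  assumes d: "d \<ge> 2"
  obtains R :: "complex poly" where "real (degree R) \<le> 48 * real d * ln d" and "poly R 1 = 1"
    and "\<And>v. norm v = 1 \<Longrightarrow> norm (poly R v) \<le> 1"
    and "\<And>w. norm w = 1 \<Longrightarrow> norm (poly R (w\<^sup>2)) \<le> 3 * exp (- (d * \<bar>Im w\<bar>))"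
proof -
  obtain L where L: "2 ^ L \<le> d" "d < 2 ^ (L + 1)"
    using ex_power_ivl1[of 2 d] d by auto
  \<comment> \<open>\<open>K\<close> is the least exponent with \<open>d < 2^K\<close>: scales
    \<open>k < K\<close> satisfy \<open>2^k \<le> d\<close>, and below the last scale
    \<open>d * \<bar>Im w\<bar> \<le> 1\<close>.\<close>
  define K where "K = L + 1"
  define Q where "Q k = geom_mean_poly (3 * 2 ^ Suc k) ^ (d div 2 ^ k + 1)" for k
  define R where "R = (\<Prod>k<K. Q k)"
  have Q1: "norm (poly (Q k) v) \<le> 1" if "norm v = 1" for k v
    unfolding Q_def poly_power norm_power
    using norm_geom_mean_poly_le_1[OF that] by (intro power_le_one) auto
  \<comment> \<open>The length grows like \<open>2^k\<close> and the exponent falls like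
    \<open>d / 2^k\<close>, so every scale costs \<open>O(d)\<close>.\<close>
  have degQ: "degree (Q k) \<le> 12 * d" if "k < K" for k
  proof -
    have "2 ^ k \<le> (2::nat) ^ L" using that by (intro power_increasing) (auto simp: K_def)
    then have k: "2 ^ k \<le> d" using L(1) by (rule order_trans)
    have "degree (Q k) \<le> degree (geom_mean_poly (3 * 2 ^ Suc k)) * (d div 2 ^ k + 1)"
      unfolding Q_def by (rule degree_power_le)
    also have "\<dots> \<le> 3 * 2 ^ Suc k * (d div 2 ^ k + 1)"
      by (intro mult_right_mono degree_geom_mean_poly) auto
    also have "\<dots> = 6 * (2 ^ k * (d div 2 ^ k)) + 6 * 2 ^ k" by (simp add: algebra_simps)
    also have "\<dots> \<le> 6 * d + 6 * d"
      using k by (intro add_mono mult_left_mono) auto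
    finally show ?thesis by simp
  qed
  have "degree R \<le> (\<Sum>k<K. degree (Q k))"
    unfolding R_def using degree_prod_sum_le[of "{..<K}" Q] by simp
  also have "\<dots> \<le> (\<Sum>k<K. 12 * d)" using degQ by (intro sum_mono) auto
  finally have "real (degree R) \<le> real (12 * d * K)"
    by (subst of_nat_le_iff) (simp add: mult.commute)
  \<comment> \<open>Since \<open>d \<ge> 2\<close>, \<open>2^K = 2 * 2^L \<le> d * d\<close>; then
    \<open>ln 2 \<ge> 1/2\<close> gives the factor 4, and \<open>48 = 12 * 4\<close>.\<close>
  moreover have "real K \<le> 4 * ln d"
  proof -
    have "real (2 ^ K) \<le> real (d * d)"
      using L(1) d by (subst of_nat_le_iff) (auto simp: K_def intro!: mult_mono)
    then have "ln (2 ^ K) \<le> ln (real d * real d)"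
      by (subst ln_le_cancel_iff) (use d in auto)
    then have "K * ln 2 \<le> 2 * ln d"
      using d by (simp add: ln_realpow ln_mult)
    moreover have "real K * (1/2) \<le> K * ln 2"
      using half_le_ln_2 by (intro mult_left_mono) auto
    ultimately show ?thesis by simp
  qed
  then have "12 * real d * real K \<le> 12 * real d * (4 * ln d)"
    by (intro mult_left_mono) auto
  ultimately have 1: "real (degree R) \<le> 48 * real d * ln d" by (simp add: mult_ac)
  have 2: "poly R 1 = 1"
    by (simp add: R_def Q_def poly_prod poly_geom_mean_poly)
  have 3: "norm (poly R v) \<le> 1" if "norm v = 1" for v
    unfolding R_def poly_prod prod_norm[symmetric] using Q1[OF that] by (intro prod_le_1) auto
  have 4: "norm (poly R (w\<^sup>2)) \<le> 3 * exp (- (d * \<bar>Im w\<bar>))" if w: "norm w = 1" for w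
  proof -
    have w2: "norm (w\<^sup>2) = 1" using w by (simp add: norm_power)
    have "\<bar>Im w\<bar> \<le> 1" using abs_Im_le_cmod[of w] w by simp
    from dyadic_scale[OF this, of K] show ?thesis
    proof (elim disjE exE conjE)
      \<comment> \<open>No factor needs to decay here: the right-hand side is at least
        \<open>3 / e \<ge> 1\<close>, which is why the claim carries a factor 3.\<close>
      assume "\<bar>Im w\<bar> \<le> (1/2) ^ K"
      then have "d * \<bar>Im w\<bar> \<le> d * (1/2) ^ K" by (intro mult_left_mono) auto
      also have "real d \<le> 2 ^ K"
        using L(2) unfolding K_def by (metis of_nat_le_iff of_nat_numeral of_nat_power less_imp_le)
      then have "d * (1/2) ^ K \<le> 1" by (simp add: power_divide field_simps)
      finally have "exp (-1) \<le> exp (- (d * \<bar>Im w\<bar>))" by simp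
      moreover have "1 / 3 \<le> exp (-1 :: real)"
        using exp_le by (simp add: exp_minus field_simps)
      ultimately show ?thesis using 3[OF w2] by linarith
    next
      fix k assume k: "k < K" "(1/2) ^ Suc k \<le> \<bar>Im w\<bar>" "\<bar>Im w\<bar> \<le> (1/2) ^ k"
      have "norm (poly R (w\<^sup>2)) =
          norm (poly (Q k) (w\<^sup>2)) * (\<Prod>l\<in>{..<K} - {k}. norm (poly (Q l) (w\<^sup>2)))"
        unfolding R_def poly_prod prod_norm[symmetric] using k(1) by (subst prod.remove) auto
      also have "\<dots> \<le> norm (poly (Q k) (w\<^sup>2)) * 1"
        using Q1[OF w2] by (intro mult_left_mono prod_le_1) auto
      also have "\<dots> \<le> exp (- (d * \<bar>Im w\<bar>))"
        using dyadic_kernel_decay[OF w k(2,3), of d] by (simp add: Q_def)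
      also have "\<dots> \<le> 3 * exp (- (d * \<bar>Im w\<bar>))" by simp
      finally show ?thesis .
    qed
  qed
  show ?thesis using that[OF 1 2 3 4] .
qed

text \<open>The growth hypothesis alone bounds \<open>h\<close> on the circle only by
  \<open>exp d\<close>. Multiplying by the decaying \<open>R\<close> flattens this to 3 at the price
  of degree \<open>O(d log d)\<close>; since \<open>R(1) = 1\<close>, the product rule recovers
  \<open>h'(1)\<close>.\<close>

lemma norm_pderiv_at_1_le_of_exp_growth:
  fixes h :: "complex poly"
  assumes d: "d \<ge> 2" and deg: "degree h \<le> d"
    and h: "\<And>w. norm w = 1 \<Longrightarrow> norm (poly h (w\<^sup>2)) \<le> exp (d * \<bar>Im w\<bar>)"
  shows "norm (poly (pderiv h) 1) \<le> 600 * real d * ln d"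
proof -
  obtain R :: "complex poly" where R: "real (degree R) \<le> 48 * real d * ln d" "poly R 1 = 1"
    "\<And>v. norm v = 1 \<Longrightarrow> norm (poly R v) \<le> 1"
    "\<And>w. norm w = 1 \<Longrightarrow> norm (poly R (w\<^sup>2)) \<le> 3 * exp (- (d * \<bar>Im w\<bar>))"
    using exists_decaying_poly[OF d] by blast
  define n where "n = d + degree R"
  have "degree (h * R) \<le> n" "degree R \<le> n" "n > 0"
    using degree_mult_le[of h R] deg d by (auto simp: n_def)
  moreover have "norm (poly (h * R) v) \<le> 3" if "norm v = 1" for v
  proof -
    \<comment> \<open>The bounds on \<open>h\<close> and \<open>R\<close> are phrased at
      \<open>w^2\<close>, so a square root of \<open>v\<close> is taken.\<close>
    have w: "norm (csqrt v) = 1" using that by simp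
    have "norm (poly (h * R) v) = norm (poly h ((csqrt v)\<^sup>2)) * norm (poly R ((csqrt v)\<^sup>2))"
      by (simp add: norm_mult)
    also have "\<dots> \<le> exp (d * \<bar>Im (csqrt v)\<bar>) * (3 * exp (- (d * \<bar>Im (csqrt v)\<bar>)))"
      by (intro mult_mono h R w) auto
    also have "\<dots> = 3" by (simp add: exp_minus)
    finally show ?thesis .
  qed
  ultimately have HR: "norm (poly (pderiv (h * R)) 1) \<le> exp 1 * 3 * n"
    and R': "norm (poly (pderiv R) 1) \<le> exp 1 * 1 * n"
    using R(3) by (intro bernstein_unit_circle; simp)+
  have "poly (pderiv h) 1 = poly (pderiv (h * R)) 1 - poly h 1 * poly (pderiv R) 1"
    using R(2) by (simp add: pderiv_mult)
  then have "norm (poly (pderiv h) 1)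
      \<le> norm (poly (pderiv (h * R)) 1) + norm (poly h 1) * norm (poly (pderiv R) 1)"
    by (metis norm_mult norm_triangle_ineq4)
  \<comment> \<open>At \<open>w = 1\<close> the growth bound reads
    \<open>norm (poly h 1) \<le> 1\<close>. With \<open>e \<le> 3\<close> and
    \<open>n \<le> 50 * d * ln d\<close>, the constant becomes
    \<open>3 * 4 * 50 = 600\<close>.\<close>
  also have "\<dots> \<le> exp 1 * 3 * n + 1 * (exp 1 * 1 * n)"
    using h[of 1] by (intro add_mono mult_mono HR R') auto
  also have "\<dots> = exp 1 * (4 * real n)" by simp
  also have "\<dots> \<le> 3 * (4 * real n)"
    using exp_le by (intro mult_right_mono) auto
  also have "real n \<le> 50 * real d * ln d"
  proof -
    have "1 / 2 \<le> ln (real d)"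
      using half_le_ln_2 by (rule order_trans) (use d in simp)
    then have "d * (1 / 2) \<le> d * ln d" by (intro mult_left_mono) auto
    then show ?thesis using R(1) by (simp add: n_def)
  qed
  finally show ?thesis by simp
qed

section \<open>Homogeneous multilinear forms\<close>

text \<open>The form is affine in each coordinate, so its modulus is largest at an endpoint. The
  induction freezes coordinate \<open>a\<close> at \<open>y a\<close>, and \<open>c'\<close> holds
  the coefficients of the resulting form.\<close>

lemma multilinear_bounded_on_box:
  fixes c :: "'a set \<Rightarrow> real"
  assumes "finite A"
    and "\<And>x. x \<in> A \<rightarrow>\<^sub>E {-1, 1} \<Longrightarrow> \<bar>\<Sum>S\<in>Pow A. c S * (\<Prod>i\<in>S. x i)\<bar> \<le> B"
    and "\<And>i. i \<in> A \<Longrightarrow> \<bar>y i\<bar> \<le> 1"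
  shows "\<bar>\<Sum>S\<in>Pow A. c S * (\<Prod>i\<in>S. y i)\<bar> \<le> B"
  using assms
proof (induction A arbitrary: c rule: finite_induct)
  case empty
  then show ?case by auto
next
  case (insert a A)
  define t where "t = y a"
  have t: "\<bar>t\<bar> \<le> 1" using insert.prems(2) by (simp add: t_def)
  define c' where "c' S = c S + t * c (insert a S)" for S
  have split: "(\<Sum>S\<in>Pow A. c' S * (\<Prod>i\<in>S. x i)) =
      (\<Sum>S\<in>Pow A. c S * (\<Prod>i\<in>S. x i)) + t * (\<Sum>S\<in>Pow A. c (insert a S) * (\<Prod>i\<in>S. x i))" for x
    by (simp add: c'_def sum_distrib_left sum.distrib algebra_simps)
  have "\<bar>\<Sum>S\<in>Pow A. c' S * (\<Prod>i\<in>S. x i)\<bar> \<le> B" if x: "x \<in> A \<rightarrow>\<^sub>E {-1, 1}" for x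
  proof -
    let ?p = "\<Sum>S\<in>Pow A. c S * (\<Prod>i\<in>S. x i)"
    let ?q = "\<Sum>S\<in>Pow A. c (insert a S) * (\<Prod>i\<in>S. x i)"
    have "x(a := u) \<in> insert a A \<rightarrow>\<^sub>E {-1, 1}" if "u \<in> {-1, 1}" for u
      using x that by (auto simp: PiE_iff extensional_def)
    from insert.prems(1)[OF this[of 1]] insert.prems(1)[OF this[of "-1"]]
    have pq: "\<bar>?p + ?q\<bar> \<le> B" "\<bar>?p - ?q\<bar> \<le> B"
      unfolding sum_Pow_insert[OF insert.hyps] prod_upd_Pow[OF insert.hyps(2)] by simp_all
    have "\<bar>t * ?q\<bar> \<le> \<bar>?q\<bar>"
      using t by (simp add: abs_mult mult_left_le_one_le)
    then show ?thesis unfolding split using pq by linarith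
  qed
  then have "\<bar>\<Sum>S\<in>Pow A. c' S * (\<Prod>i\<in>S. y i)\<bar> \<le> B"
    using insert.prems(2) by (intro insert.IH) auto
  then show ?case
    unfolding sum_Pow_insert[OF insert.hyps] split t_def .
qed

text \<open>The coefficient type is general because both a real scaling and a complex rotation are
  pulled out later.\<close>

lemma homogeneous_multilinear_scale:
  fixes c :: "'a set \<Rightarrow> 'b::comm_semiring_1"
  assumes "\<And>S. S \<subseteq> A \<Longrightarrow> c S \<noteq> 0 \<Longrightarrow> card S = d"
  shows "(\<Sum>S\<in>Pow A. c S * (\<Prod>i\<in>S. l * y i)) = l ^ d * (\<Sum>S\<in>Pow A. c S * (\<Prod>i\<in>S. y i))"
  unfolding sum_distrib_left
proof (rule sum.cong[OF refl])
  fix S assume "S \<in> Pow A"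
  then show "c S * (\<Prod>i\<in>S. l * y i) = l ^ d * (c S * (\<Prod>i\<in>S. y i))"
    using assms[of S] by (cases "c S = 0") (auto simp: prod.distrib mult_ac)
qed

text \<open>Dividing by \<open>l\<close> moves \<open>y\<close> into the unit box; homogeneity
  restores the factor \<open>l^d\<close>.\<close>

lemma homogeneous_multilinear_growth:
  fixes c :: "'a set \<Rightarrow> real"
  assumes A: "finite A" and hom: "\<And>S. S \<subseteq> A \<Longrightarrow> c S \<noteq> 0 \<Longrightarrow> card S = d"
    and bd: "\<And>x. x \<in> A \<rightarrow>\<^sub>E {-1, 1} \<Longrightarrow> \<bar>\<Sum>S\<in>Pow A. c S * (\<Prod>i\<in>S. x i)\<bar> \<le> 1"
    and y: "\<And>i. i \<in> A \<Longrightarrow> \<bar>y i\<bar> \<le> l" and l: "l > 0"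
  shows "\<bar>\<Sum>S\<in>Pow A. c S * (\<Prod>i\<in>S. y i)\<bar> \<le> l ^ d"
proof -
  have "\<bar>\<Sum>S\<in>Pow A. c S * (\<Prod>i\<in>S. y i / l)\<bar> \<le> 1"
  proof (rule multilinear_bounded_on_box[OF A bd])
    show "\<bar>y i / l\<bar> \<le> 1" if "i \<in> A" for i
      using y[OF that] l by (simp add: abs_divide)
  qed
  moreover have "(\<Sum>S\<in>Pow A. c S * (\<Prod>i\<in>S. y i)) = (\<Sum>S\<in>Pow A. c S * (\<Prod>i\<in>S. l * (y i / l)))"
    using l by simp
  ultimately show ?thesis
    using homogeneous_multilinear_scale[of A c d l "\<lambda>i. y i / l"] hom l
    by (simp add: abs_mult)
qed

text \<open>The left-hand side is the sum of \<open>s i * x i\<close> times the partial derivatives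
  of the extension at \<open>x\<close>, and equals \<open>-2 Im h'(1)\<close>; hence
  \<open>1200 = 2 * 600\<close>. Allowing all \<open>\<bar>s i\<bar> \<le> 1\<close> covers
  vanishing signs.\<close>

lemma homogeneous_signed_gradient_le:
  fixes c :: "'a set \<Rightarrow> real"
  assumes A: "finite A" and hom: "\<And>S. S \<subseteq> A \<Longrightarrow> c S \<noteq> 0 \<Longrightarrow> card S = d"
    and bd: "\<And>x. x \<in> A \<rightarrow>\<^sub>E {-1, 1} \<Longrightarrow> \<bar>\<Sum>S\<in>Pow A. c S * (\<Prod>i\<in>S. x i)\<bar> \<le> 1"
    and d: "d \<ge> 2" and x: "x \<in> A \<rightarrow>\<^sub>E {-1, 1}" and s: "\<And>i. \<bar>s i\<bar> \<le> (1::real)"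
  shows "(\<Sum>i\<in>A. s i * (\<Sum>S | S \<subseteq> A \<and> i \<in> S. c S * (\<Prod>j\<in>S. x j))) \<le> 1200 * real d * ln d"
proof -
  \<comment> \<open>A line through \<open>x i\<close> at \<open>v = 1\<close> whose slope has
    imaginary part \<open>- s i * x i / 2\<close>, which puts the weights \<open>s i\<close> into
    \<open>Im h'(1)\<close>.\<close>
  define l where "l i = [:of_real (x i) * (1 + \<i> * of_real (s i)) / 2,
    of_real (x i) * (1 - \<i> * of_real (s i)) / 2:]" for i
  define h where "h = (\<Sum>S\<in>Pow A. smult (of_real (c S)) (\<Prod>i\<in>S. l i))"
  have l1: "poly (l i) 1 = of_real (x i)" for i
    by (simp add: l_def field_simps)
  have "degree (smult (of_real (c S)) (\<Prod>i\<in>S. l i)) \<le> d" if "S \<in> Pow A" for S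
  proof (cases "c S = 0")
    case False
    have fin: "finite S" using that A finite_subset by auto
    have "degree (\<Prod>i\<in>S. l i) \<le> (\<Sum>i\<in>S. degree (l i))"
      using degree_prod_sum_le[OF fin, of l] by simp
    also have "\<dots> \<le> (\<Sum>i\<in>S. 1)" by (intro sum_mono) (simp add: l_def)
    also have "\<dots> = d" using hom[of S] that False by simp
    finally show ?thesis using False by simp
  qed simp
  then have deg: "degree h \<le> d"
    unfolding h_def using A by (intro degree_sum_le) auto
  have growth: "norm (poly h (w\<^sup>2)) \<le> exp (d * \<bar>Im w\<bar>)" if w: "norm w = 1" for w
  proof -
    \<comment> \<open>At \<open>v = w^2\<close> each argument is \<open>w\<close> times the real
      number \<open>y i\<close>; homogeneity extracts \<open>w^d\<close> and leaves a real
      form.\<close>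
    define y where "y i = x i * (Re w + s i * Im w)" for i
    have ww: "w * cnj w = 1" using w by (simp add: complex_norm_square[symmetric])
    have "poly (l i) (w\<^sup>2) = w * of_real (y i)" for i
    proof -
      have re_im: "of_real (Re w) = (w + cnj w) / 2" "of_real (Im w) = (w - cnj w) / (2 * \<i>)"
        by (simp_all add: complex_eq_iff)
      have "w * of_real (y i) = of_real (x i) *
          ((w * w + w * cnj w) / 2 + of_real (s i) * (w * w - w * cnj w) / (2 * \<i>))"
        unfolding y_def of_real_mult of_real_add re_im by (simp add: field_simps)
      also have "\<dots> = poly (l i) (w\<^sup>2)"
        unfolding ww by (simp add: l_def power2_eq_square field_simps)
      finally show ?thesis by simp
    qed
    then have "poly h (w\<^sup>2) = (\<Sum>S\<in>Pow A. of_real (c S) * (\<Prod>i\<in>S. w * of_real (y i)))"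
      by (simp add: h_def poly_sum poly_prod)
    also have "\<dots> = w ^ d * (\<Sum>S\<in>Pow A. of_real (c S) * (\<Prod>i\<in>S. of_real (y i)))"
      using hom by (intro homogeneous_multilinear_scale) auto
    also have "\<dots> = w ^ d * of_real (\<Sum>S\<in>Pow A. c S * (\<Prod>i\<in>S. y i))" by simp
    finally have "norm (poly h (w\<^sup>2)) = \<bar>\<Sum>S\<in>Pow A. c S * (\<Prod>i\<in>S. y i)\<bar>"
      using w by (simp only: norm_mult norm_power norm_of_real power_one mult_1_left)
    also have "\<dots> \<le> (1 + \<bar>Im w\<bar>) ^ d"
    proof (rule homogeneous_multilinear_growth[OF A hom bd])
      fix i assume "i \<in> A"
      then have "\<bar>x i\<bar> = 1" using x by (auto simp: PiE_iff)
      then have "\<bar>y i\<bar> = \<bar>Re w + s i * Im w\<bar>" by (simp add: y_def abs_mult)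
      also have "\<dots> \<le> \<bar>Re w\<bar> + \<bar>s i\<bar> * \<bar>Im w\<bar>"
        by (metis abs_mult abs_triangle_ineq)
      also have "\<dots> \<le> 1 + 1 * \<bar>Im w\<bar>"
        using abs_Re_le_cmod[of w] w s by (intro add_mono mult_right_mono) auto
      finally show "\<bar>y i\<bar> \<le> 1 + \<bar>Im w\<bar>" by simp
    qed auto
    also have "\<dots> \<le> exp \<bar>Im w\<bar> ^ d"
      by (intro power_mono exp_ge_add_one_self) auto
    finally show ?thesis by (simp add: exp_of_nat_mult)
  qed
  have pd: "poly (pderiv (\<Prod>i\<in>S. l i)) 1 =
      (\<Sum>i\<in>S. of_real (\<Prod>j\<in>S. x j) * (1 - \<i> * of_real (s i)) / 2)" if "S \<in> Pow A" for S
  proof -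
    have fin: "finite S" using that A finite_subset by auto
    have "poly (\<Prod>j\<in>S - {i}. l j) 1 * poly (pderiv (l i)) 1 =
        of_real (\<Prod>j\<in>S. x j) * (1 - \<i> * of_real (s i)) / 2" if "i \<in> S" for i
      using prod.remove[OF fin that, of x]
      by (simp add: poly_prod l1) (simp add: l_def pderiv_pCons mult_ac)
    then show ?thesis unfolding pderiv_prod poly_sum poly_mult by (rule sum.cong[OF refl])
  qed
  have "Im (poly (pderiv h) 1) =
      (\<Sum>S\<in>Pow A. Im (of_real (c S) * poly (pderiv (\<Prod>i\<in>S. l i)) 1))"
    by (simp add: h_def higher_pderiv_sum[of 1, simplified] poly_sum pderiv_smult)
  also have "\<dots> = (\<Sum>S\<in>Pow A. \<Sum>i\<in>S. - (s i * (c S * (\<Prod>j\<in>S. x j))) / 2)"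
  proof (rule sum.cong[OF refl])
    fix S assume S: "S \<in> Pow A"
    have "Im (of_real (c S) * poly (pderiv (\<Prod>i\<in>S. l i)) 1) =
        c S * (\<Sum>i\<in>S. Im (of_real (\<Prod>j\<in>S. x j) * (1 - \<i> * of_real (s i)) / 2))"
      unfolding pd[OF S] by (simp del: of_real_prod)
    also have "\<dots> = (\<Sum>i\<in>S. - (s i * (c S * (\<Prod>j\<in>S. x j))) / 2)"
      by (simp add: sum_distrib_left mult_ac del: of_real_prod)
    finally show "Im (of_real (c S) * poly (pderiv (\<Prod>i\<in>S. l i)) 1) =
        (\<Sum>i\<in>S. - (s i * (c S * (\<Prod>j\<in>S. x j))) / 2)" .
  qed
  also have "\<dots> = (\<Sum>S\<in>Pow A. \<Sum>i | i \<in> A \<and> i \<in> S. - (s i * (c S * (\<Prod>j\<in>S. x j))) / 2)"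
    by (intro sum.cong refl) auto
  also have "\<dots> = (\<Sum>i\<in>A. \<Sum>S | S \<in> Pow A \<and> i \<in> S. - (s i * (c S * (\<Prod>j\<in>S. x j))) / 2)"
    using A by (intro sum.swap_restrict) auto
  also have "\<dots> = - (\<Sum>i\<in>A. s i * (\<Sum>S | S \<subseteq> A \<and> i \<in> S. c S * (\<Prod>j\<in>S. x j))) / 2"
    by (simp add: sum_distrib_left sum_divide_distrib sum_negf)
  finally have "(\<Sum>i\<in>A. s i * (\<Sum>S | S \<subseteq> A \<and> i \<in> S. c S * (\<Prod>j\<in>S. x j))) =
      - (2 * Im (poly (pderiv h) 1))"
    by simp
  also have "\<dots> \<le> 2 * norm (poly (pderiv h) 1)"
    using abs_Im_le_cmod[of "poly (pderiv h) 1"] by linarith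
  also have "norm (poly (pderiv h) 1) \<le> 600 * real d * ln d"
    using norm_pderiv_at_1_le_of_exp_growth[OF d deg growth] .
  finally show ?thesis by simp
qed

section \<open>Sensitivity and influence\<close>

text \<open>Flipping coordinate \<open>i\<close> negates exactly the monomials containing
  \<open>i\<close>, and the halved difference keeps just these.\<close>

lemma partial_diff_multilinear:
  assumes f: "represents n c f" and x: "x \<in> cube n" and i: "i \<in> {1..n}"
  shows "partial_diff i f x = (\<Sum>S | S \<subseteq> {1..n} \<and> i \<in> S. c S * (\<Prod>j\<in>S. x j))"
proof -
  have flip: "(\<Prod>j\<in>S. flip i x j) = (if i \<in> S then - (\<Prod>j\<in>S. x j) else (\<Prod>j\<in>S. x j))"
    if "S \<in> Pow {1..n}" for S
  proof -
    have fin: "finite S" using that finite_subset by auto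
    have rest: "(\<Prod>j\<in>S - {i}. flip i x j) = (\<Prod>j\<in>S - {i}. x j)"
      by (intro prod.cong) (auto simp: flip_def)
    show ?thesis
    proof (cases "i \<in> S")
      case True
      then show ?thesis
        using prod.remove[OF fin True, of x] prod.remove[OF fin True, of "flip i x"] rest
        by (simp add: flip_def)
    next
      case False
      then show ?thesis using rest by simp
    qed
  qed
  have "partial_diff i f x = (multilinear n c x - multilinear n c (flip i x)) / 2"
    using f x flip_in_cube[OF x i] by (simp add: partial_diff_def represents_def)
  also have "\<dots> = (\<Sum>S\<in>Pow {1..n}. (c S * (\<Prod>j\<in>S. x j) - c S * (\<Prod>j\<in>S. flip i x j)) / 2)"
    by (simp add: multilinear_def sum_subtractf flip: sum_divide_distrib)
  also have "\<dots> = (\<Sum>S\<in>Pow {1..n}. if i \<in> S then c S * (\<Prod>j\<in>S. x j) else 0)"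
    using flip by (intro sum.cong) auto
  also have "\<dots> = (\<Sum>S\<in>Pow {1..n} \<inter> {S. i \<in> S}. c S * (\<Prod>j\<in>S. x j))"
    by (simp add: sum.inter_restrict)
  also have "Pow {1..n} \<inter> {S. i \<in> S} = {S. S \<subseteq> {1..n} \<and> i \<in> S}" by auto
  finally show ?thesis .
qed

lemma card_eq_cube_degree:
  assumes hom: "homogeneous n f" and S: "S \<subseteq> {1..n}" "fourier_coeff n f S \<noteq> 0"
  shows "card S = cube_degree n f"
proof -
  have "S \<in> fourier_support n f" using S by (simp add: fourier_support_def)
  with hom have "card ` fourier_support n f = {card S}"
    unfolding homogeneous_def by blast
  then show ?thesis by (simp add: cube_degree_def)
qed

lemma sensitivity_homogeneous_le:
  assumes f: "f \<in> cube n \<rightarrow> {-1..1}" and hom: "homogeneous n f"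
    and d: "cube_degree n f = d" "d \<ge> 2" and x: "x \<in> cube n"
  shows "sensitivity n f x \<le> 1200 * real d * ln d"
proof -
  define c where "c = fourier_coeff n f"
  have c: "represents n c f" unfolding c_def by (rule represents_fourier_coeff)
  \<comment> \<open>The signs at the fixed point \<open>x\<close> serve as the weights
    \<open>s i\<close>.\<close>
  have "sensitivity n f x = (\<Sum>i=1..n. sgn (partial_diff i f x) * partial_diff i f x)"
    by (simp add: sensitivity_def linordered_idom_class.abs_sgn mult.commute)
  also have "\<dots> = (\<Sum>i=1..n. sgn (partial_diff i f x) *
      (\<Sum>S | S \<subseteq> {1..n} \<and> i \<in> S. c S * (\<Prod>j\<in>S. x j)))"
    using partial_diff_multilinear[OF c x] by (intro sum.cong) auto
  also have "\<dots> \<le> 1200 * real d * ln d"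
  proof (rule homogeneous_signed_gradient_le)
    show "card S = d" if "S \<subseteq> {1..n}" "c S \<noteq> 0" for S
      using card_eq_cube_degree[OF hom] that d by (simp add: c_def)
    show "\<bar>\<Sum>S\<in>Pow {1..n}. c S * (\<Prod>i\<in>S. y i)\<bar> \<le> 1" if "y \<in> {1..n} \<rightarrow>\<^sub>E {-1, 1}" for y
    proof -
      have y: "y \<in> cube n" using that by (simp add: cube_def)
      then have "f y = (\<Sum>S\<in>Pow {1..n}. c S * (\<Prod>i\<in>S. y i))"
        using c by (simp add: represents_def multilinear_def)
      moreover have "f y \<in> {-1..1}" using f y by blast
      ultimately show ?thesis by (simp add: abs_le_iff)
    qed
    show "\<bar>sgn (partial_diff i f x)\<bar> \<le> 1" for i by (simp add: sgn_if)
  qed (use d x in \<open>auto simp: cube_def\<close>)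
  finally show ?thesis .
qed

text \<open>Exchanging sums shows that the influence is the mean of the sensitivity over the
  cube.\<close>

lemma total_influence_le_max_sensitivity: "total_influence n f \<le> max_sensitivity n f"
proof -
  have card: "real (card (cube n)) > 0"
    using finite_cube cube_nonempty by (simp add: card_gt_0_iff)
  have "total_influence n f = (\<Sum>x\<in>cube n. sensitivity n f x) / card (cube n)"
    unfolding total_influence_def cube_expectation_def sensitivity_def sum_divide_distrib[symmetric]
    by (subst sum.swap) simp
  also have "\<dots> \<le> (\<Sum>x\<in>cube n. max_sensitivity n f) / card (cube n)"
    unfolding max_sensitivity_def
    by (intro divide_right_mono sum_mono Max_ge) (auto simp: finite_cube)
  also have "\<dots> = max_sensitivity n f" using card by simp
  finally show ?thesis .
qed

theorem theorem3p6:
  "\<exists>C::real. \<forall>(n::nat) (d::nat) (f :: (nat \<Rightarrow> real) \<Rightarrow> real).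
     f \<in> cube n \<rightarrow> {-1..1} \<longrightarrow> homogeneous n f \<longrightarrow> cube_degree n f = d \<longrightarrow> d \<ge> 2 \<longrightarrow>
       total_influence n f \<le> max_sensitivity n f \<and>
       max_sensitivity n f \<le> C * real d * ln (real d)"
proof (intro exI allI impI conjI)
  fix n d :: nat and f :: "(nat \<Rightarrow> real) \<Rightarrow> real"
  assume *: "f \<in> cube n \<rightarrow> {-1..1}" "homogeneous n f" "cube_degree n f = d" "d \<ge> 2"
  show "total_influence n f \<le> max_sensitivity n f"
    by (rule total_influence_le_max_sensitivity)
  show "max_sensitivity n f \<le> 1200 * real d * ln (real d)"
    unfolding max_sensitivity_def using sensitivity_homogeneous_le[OF *]
    by (subst Max_le_iff) (auto simp: finite_cube cube_nonempty)
qed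

end
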